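(* Let $N, K \in \mathbb{N}$, $b > 0$, $\epsilon > 0$. Let $\{w_k^i : 1 \leq i \leq N,\ 1 \leq k \leq K\}$ be mutually independent random variables, each with distribution $\mathrm{Lap}(b/\epsilon)$, and for each $k \in \{1,\dots,K\}$ let $\tilde{d}_k = \sum_{i=1}^N w_k^i$ be the error in the private aggregate demand at time $k$. Assume $N$ is large enough that $\tilde{d}_k$ is approximately Gaussian for all $k$. Then $$0.478\,\sqrt{N}\,\frac{b}{\epsilon}\,\sqrt{\log K} \;\leq\; \mathbb{E}\left[\max_{1 \leq k \leq K} \tilde{d}_k\right] \;\leq\; 2\,\frac{b}{\epsilon}\,\sqrt{N}\,\sqrt{\log K},$$ and the variance of the maximum, for any $K \in \mathbb{N}$, satisfies $$\mathrm{var}\left[\max_{1 \leq k \leq K} \tilde{d}_k\right] \leq 8N\,\frac{b^2}{\epsilon^2}.$$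
   Context: $\mathrm{Lap}(c)$ is the Laplace distribution with mean $0$ and scale $c$ (density $\frac{1}{2c}e^{-|x|/c}$, variance $2c^2$); $\log$ is the natural logarithm. Setting: customer $i \in \{1,\dots,N\}$ has true power demand $d^i_k$ at time $k$; the utility only sees the private demand $\hat d^i_k = d^i_k + w^i_k$. The aggregate demand is $d_k = \sum_i d^i_k$, the private aggregate demand is $\hat d_k = \sum_i \hat d_k^i$, and $\tilde d_k = \hat d_k - d_k = \sum_i w_k^i$. "$\tilde d_k$ is approximately Gaussian for all $k$" means that, in the conclusions, $\tilde d_1,\dots,\tilde d_K$ are treated as i.i.d. Gaussian random variables with the mean and variance of $\sum_i w_k^i$, namely mean $0$ and variance $2N\frac{b^2}{\epsilon^2}$. *)

theory Defs
  imports "HOL-Probability.Probability"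
begin

text \<open>The Laplace distribution with mean 0 and scale \<open>c > 0\<close>.\<close>

definition laplace_density :: "real \<Rightarrow> real \<Rightarrow> real" where
  "laplace_density c x = exp (- \<bar>x\<bar> / c) / (2 * c)"

definition aggregate_error :: "nat \<Rightarrow> (nat \<Rightarrow> nat \<Rightarrow> 'a \<Rightarrow> real) \<Rightarrow> nat \<Rightarrow> 'a \<Rightarrow> real" where
  "aggregate_error N w k \<omega> = (\<Sum>i = 1..N. w i k \<omega>)"

text \<open>A sum of Laplace variables is never exactly Gaussian, so assuming this of \<open>X k\<close> itself would
  be contradictory. Treating the family \<open>X\<close> as i.i.d. Gaussian means reasoning about a family \<open>Y\<close>,
  possibly on another probability space, of independent Gaussian variables in which \<open>Y k\<close> has the
  mean and the variance of \<open>X k\<close>. The second parameter of \<^const>\<open>normal_density\<close> is the standard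
  deviation.\<close>

definition gaussian_surrogate ::
    "'i set \<Rightarrow> 'a measure \<Rightarrow> ('i \<Rightarrow> 'a \<Rightarrow> real) \<Rightarrow> 'b measure \<Rightarrow> ('i \<Rightarrow> 'b \<Rightarrow> real) \<Rightarrow> bool" where
  "gaussian_surrogate I M X P Y \<longleftrightarrow>
     prob_space.indep_vars P (\<lambda>_. borel) Y I \<and>
     (\<forall>k\<in>I. distributed P lborel (Y k)
        (normal_density (prob_space.expectation M (X k)) (sqrt (prob_space.variance M (X k)))))"

end

theory Submission
  imports Defs "HOL-Real_Asymp.Real_Asymp"
begin

text \<open>
  A Laplace variable of scale \<open>c\<close> has mean 0 and variance \<open>2 * c\<^sup>2\<close>, and variances of independent
  variables add up. So the Gaussian variables \<open>d k\<close> have mean 0 and standard deviation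
  \<open>\<sigma> = sqrt (2 * N) * b / \<epsilon>\<close>, and after division by \<open>\<sigma>\<close> everything is a statement about the
  maximum \<open>Z\<close> of \<open>K\<close> independent standard Gaussians:
  \<open>0.3381 * sqrt (ln K) \<le> E Z \<le> sqrt (2 * ln K)\<close> and \<open>Var Z \<le> 1\<close>.

  The upper bound on the expectation (\<open>expectation_Max_std_normal_le\<close>) is the usual argument with
  exponential moments.

  The lower bound (\<open>sqrt_ln_le_expectation_Max_std_normal\<close>) lies a factor 2 below the optimal constant
  \<open>1 / sqrt (pi * ln 2)\<close>, which leaves room for a short proof. Up to 16 variables, two of them suffice.
  Beyond that, with probability bounded away from 0 one of the variables exceeds
  \<open>sqrt (ln K) / 2\<close>, and by \<open>expectation_Max_std_normal_ge\<close> the possibly negative maximum in the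
  remaining case does not spoil the bound.

  The bound on the variance (\<open>variance_Max_std_normal_le_1\<close>) is uniform in \<open>K\<close> because the density of
  \<open>Z\<close> is even more log-concave than the Gaussian: it is a constant times the Gaussian density times a
  power of the Gaussian distribution function, which is itself log-concave
  (\<open>std_normal_cdf_cross_le\<close>). One integration by parts turns this into \<open>Var Z \<le> 1\<close>. The bound
  proved is thus \<open>\<sigma>\<^sup>2\<close>, a quarter of the one claimed.
\<close>

section \<open>Moments of the aggregate Laplace error\<close>

text \<open>By symmetry only the even moments survive, and there the integral over the half-line is a
  Gamma integral.\<close>

lemma laplace_moment:
  assumes c: "c > 0"
  shows "has_bochner_integral lborel (\<lambda>x. laplace_density c x * x ^ k)
           (if even k then c ^ k * fact k else 0)"
proof -
  let ?f = "\<lambda>x::real. exp (- \<bar>x\<bar>) / 2 * x ^ k"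
  have "has_bochner_integral lborel (\<lambda>x::real. x ^ k * exp (- x) * indicator {0..} x) (fact k)"
    using nn_intergal_power_times_exp_Ici[of k]
    by (intro has_bochner_integral_nn_integral)
       (auto simp: nn_integral_multc split: split_indicator simp flip: ennreal_indicator ennreal_mult'')
  from has_bochner_integral_mult_right[OF this, of "1/2"]
  have half: "has_bochner_integral lborel (\<lambda>x. indicator {0..} x *\<^sub>R ?f x) (fact k / 2)"
    by (rule has_bochner_integral_cong[THEN iffD1, rotated -1])
       (auto split: split_indicator)
  have std: "has_bochner_integral lborel ?f (if even k then fact k else 0)"
    using has_bochner_integral_even_function[OF half] has_bochner_integral_odd_function[OF half]
    by auto
  have "(\<lambda>x. laplace_density c (0 + c * x) * (0 + c * x) ^ k) = (\<lambda>x. c ^ k / c * ?f x)"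
    using c by (simp add: laplace_density_def abs_mult power_mult_distrib mult_ac)
  then have "has_bochner_integral lborel (\<lambda>x. laplace_density c (0 + c * x) * (0 + c * x) ^ k)
      (c ^ k / c * (if even k then fact k else 0))"
    using has_bochner_integral_mult_right[OF std, of "c ^ k / c"] by (simp only:)
  moreover have "c ^ k / c * (if even k then fact k else 0) =
      (if even k then c ^ k * fact k else 0) /\<^sub>R \<bar>c\<bar>"
    using c by (simp add: divide_inverse)
  ultimately show ?thesis
    using c by (subst lborel_has_bochner_integral_real_affine_iff[where c=c and t=0]) simp_all
qed

lemma (in prob_space) laplace_distributed_moment:
  assumes "c > 0" and X: "distributed M lborel X (laplace_density c)"
  shows "integrable M (\<lambda>\<omega>. X \<omega> ^ k)"
    and "expectation (\<lambda>\<omega>. X \<omega> ^ k) = (if even k then c ^ k * fact k else 0)"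
proof -
  have nn: "0 \<le> laplace_density c x" for x
    using \<open>c > 0\<close> by (simp add: laplace_density_def)
  note mom = laplace_moment[OF \<open>c > 0\<close>, of k]
  show "integrable M (\<lambda>\<omega>. X \<omega> ^ k)"
    using distributed_integrable[OF X, of "\<lambda>x. x ^ k"] nn mom
    by (auto simp: has_bochner_integral_iff)
  show "expectation (\<lambda>\<omega>. X \<omega> ^ k) = (if even k then c ^ k * fact k else 0)"
    using distributed_integral[OF X, of "\<lambda>x. x ^ k"] nn mom
    by (auto simp: has_bochner_integral_iff)
qed

text \<open>Variances of independent variables add up: in the square of the sum the cross terms are products of
  independent centred factors, hence have expectation zero.\<close>

lemma (in prob_space) second_moment_sum_indep_centered:
  fixes X :: "'i \<Rightarrow> 'a \<Rightarrow> real"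
  assumes "finite I" "indep_vars (\<lambda>_. borel) X I"
    and "\<And>i. i \<in> I \<Longrightarrow> integrable M (X i)" "\<And>i. i \<in> I \<Longrightarrow> integrable M (\<lambda>\<omega>. X i \<omega> ^ 2)"
    and "\<And>i. i \<in> I \<Longrightarrow> expectation (X i) = 0"
  shows "integrable M (\<lambda>\<omega>. (\<Sum>i\<in>I. X i \<omega>) ^ 2) \<and>
         expectation (\<lambda>\<omega>. (\<Sum>i\<in>I. X i \<omega>) ^ 2) = (\<Sum>i\<in>I. expectation (\<lambda>\<omega>. X i \<omega> ^ 2))"
  using assms
proof (induction I rule: finite_induct)
  case empty
  then show ?case by simp
next
  case (insert j I)
  let ?S = "\<lambda>\<omega>. \<Sum>i\<in>I. X i \<omega>"
  have IH: "integrable M (\<lambda>\<omega>. ?S \<omega> ^ 2)"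
    "expectation (\<lambda>\<omega>. ?S \<omega> ^ 2) = (\<Sum>i\<in>I. expectation (\<lambda>\<omega>. X i \<omega> ^ 2))"
    using insert.IH insert.prems indep_vars_subset[OF insert.prems(1), of I] by auto
  have ind: "indep_var borel (X j) borel ?S"
    using insert by (intro indep_vars_sum) auto
  have S: "integrable M ?S" using insert.prems by auto
  have j: "integrable M (X j)" "integrable M (\<lambda>\<omega>. X j \<omega> ^ 2)" "expectation (X j) = 0"
    using insert.prems by auto
  note prod = indep_var_integrable[OF ind j(1) S] indep_var_lebesgue_integral[OF ind j(1) S]
  have eq: "(\<Sum>i\<in>insert j I. X i \<omega>) ^ 2 = X j \<omega> ^ 2 + 2 * (X j \<omega> * ?S \<omega>) + ?S \<omega> ^ 2" for \<omega>
    using insert.hyps by (simp add: power2_sum)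
  show ?case
    unfolding eq using IH j prod insert.hyps by simp
qed

lemma aggregate_error_moments:
  assumes "prob_space M" and c: "c > 0" and k: "k \<in> {1..K}"
    and ind: "prob_space.indep_vars M (\<lambda>_. borel) (\<lambda>(i, k). w i k) ({1..N} \<times> {1..K})"
    and w: "\<And>i k. i \<in> {1..N} \<Longrightarrow> k \<in> {1..K} \<Longrightarrow> distributed M lborel (w i k) (laplace_density c)"
  shows "prob_space.expectation M (aggregate_error N w k) = 0"
    and "prob_space.variance M (aggregate_error N w k) = 2 * real N * c\<^sup>2"
proof -
  interpret prob_space M by fact
  let ?X = "\<lambda>(i, k). w i k"
  let ?I = "{1..N} \<times> {k}"
  have X: "integrable M (?X p)" "integrable M (\<lambda>\<omega>. ?X p \<omega> ^ 2)" "expectation (?X p) = 0"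
      "expectation (\<lambda>\<omega>. ?X p \<omega> ^ 2) = 2 * c\<^sup>2" if "p \<in> ?I" for p
    using that laplace_distributed_moment[OF c w[of "fst p" k], of 1]
      laplace_distributed_moment[OF c w[of "fst p" k], of 2] k
    by auto
  have agg: "aggregate_error N w k = (\<lambda>\<omega>. \<Sum>p\<in>?I. ?X p \<omega>)"
    unfolding aggregate_error_def fun_eq_iff
    by (auto intro!: sum.reindex_bij_witness[of _ fst "\<lambda>i. (i, k)"])
  show 0: "expectation (aggregate_error N w k) = 0"
    unfolding agg using X by (subst Bochner_Integration.integral_sum) auto
  have "expectation (\<lambda>\<omega>. (\<Sum>p\<in>?I. ?X p \<omega>) ^ 2) = (\<Sum>p\<in>?I. expectation (\<lambda>\<omega>. ?X p \<omega> ^ 2))"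
    using X k
    by (intro second_moment_sum_indep_centered[THEN conjunct2] indep_vars_subset[OF ind]) auto
  also have "\<dots> = (\<Sum>p\<in>?I. 2 * c\<^sup>2)"
    using X by (intro sum.cong) auto
  finally show "variance (aggregate_error N w k) = 2 * real N * c\<^sup>2"
    unfolding 0 by (simp add: agg)
qed

section \<open>Upper bound on the expected maximum\<close>

text \<open>Completing the square: exponential tilting shifts the Gaussian density.\<close>

lemma exp_mult_std_normal_density:
  "std_normal_density x * exp (l * x) = exp (l\<^sup>2 / 2) * normal_density l 1 x"
proof -
  have "- x\<^sup>2 / 2 + l * x = l\<^sup>2 / 2 - (x - l)\<^sup>2 / 2"
    by (simp add: power2_eq_square field_simps)
  then show ?thesis
    by (simp add: normal_density_def flip: exp_add)
qed

lemma (in prob_space) std_normal_moment_generating_function: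
  assumes X: "distributed M lborel X std_normal_density"
  shows "integrable M (\<lambda>\<omega>. exp (l * X \<omega>))"
    and "expectation (\<lambda>\<omega>. exp (l * X \<omega>)) = exp (l\<^sup>2 / 2)"
proof -
  show "integrable M (\<lambda>\<omega>. exp (l * X \<omega>))"
    using distributed_integrable[OF X, of "\<lambda>x. exp (l * x)"]
    by (simp add: exp_mult_std_normal_density)
  show "expectation (\<lambda>\<omega>. exp (l * X \<omega>)) = exp (l\<^sup>2 / 2)"
    using distributed_integral[OF X, of "\<lambda>x. exp (l * x)"]
    by (simp add: exp_mult_std_normal_density)
qed

lemma integrable_Max:
  fixes X :: "'i \<Rightarrow> 'a \<Rightarrow> real"
  assumes "finite I" "I \<noteq> {}" "\<And>i. i \<in> I \<Longrightarrow> integrable M (X i)"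
  shows "integrable M (\<lambda>\<omega>. MAX i\<in>I. X i \<omega>)"
  using assms
proof (induction I rule: finite_ne_induct)
  case (insert i I)
  then show ?case by (auto intro!: Bochner_Integration.integrable_max)
qed auto

lemma (in prob_space) std_normal_integrable:
  assumes X: "distributed M lborel X std_normal_density"
  shows "integrable M X"
  using distributed_integrable[OF X, of "\<lambda>x. x"] integrable_std_normal_moment[of 1] by simp

text \<open>The exponential-moment (Chernoff) bound: the exponential of \<open>l\<close> times the maximum is dominated
  by the sum of the exponentials of \<open>l * Y i\<close>, whose expectation is \<open>n * exp (l\<^sup>2 / 2)\<close>. The best
  parameter is \<open>l = sqrt (2 * ln n)\<close>, for which this expectation equals \<open>exp (l\<^sup>2)\<close>. This suggests
  \<open>l\<close> as the bound, and linearising the exponential there by \<open>1 + y \<le> exp y\<close> takes the place of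
  Jensen's inequality.\<close>

lemma (in prob_space) expectation_Max_std_normal_le:
  assumes I: "finite I" "I \<noteq> {}"
    and Y: "\<And>i. i \<in> I \<Longrightarrow> distributed M lborel (Y i) std_normal_density"
  shows "expectation (\<lambda>\<omega>. MAX i\<in>I. Y i \<omega>) \<le> sqrt (2 * ln (card I))"
proof (cases "card I = 1")
  case True
  then obtain i where "I = {i}" by (rule card_1_singletonE)
  then show ?thesis
    using Y standard_normal_distributed_expectation[of "Y i"] by simp
next
  case False
  let ?Z = "\<lambda>\<omega>. MAX i\<in>I. Y i \<omega>"
  define n where "n = real (card I)"
  have "card I \<noteq> 0" using I by simp
  with False have n: "n > 1" unfolding n_def by linarith
  define l where "l = sqrt (2 * ln n)"
  have l: "l > 0" "l\<^sup>2 = 2 * ln n"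
    using n by (auto simp: l_def)
  have pointwise: "l * ?Z \<omega> \<le> l\<^sup>2 - 1 + (\<Sum>i\<in>I. exp (l * Y i \<omega>) / exp (l\<^sup>2))" for \<omega>
  proof -
    have "?Z \<omega> \<in> (\<lambda>i. Y i \<omega>) ` I" using I by (intro Max_in) auto
    then obtain i where i: "i \<in> I" "?Z \<omega> = Y i \<omega>" by auto
    have "l * ?Z \<omega> - l\<^sup>2 + 1 \<le> exp (l * Y i \<omega> - l\<^sup>2)"
      using exp_ge_add_one_self[of "l * Y i \<omega> - l\<^sup>2"] unfolding i(2) by linarith
    also have "\<dots> = exp (l * Y i \<omega>) / exp (l\<^sup>2)"
      by (simp add: exp_diff)
    also have "\<dots> \<le> (\<Sum>i\<in>I. exp (l * Y i \<omega>) / exp (l\<^sup>2))"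
      using I i by (intro member_le_sum) auto
    finally show ?thesis by simp
  qed
  have "l * expectation ?Z = expectation (\<lambda>\<omega>. l * ?Z \<omega>)"
    by simp
  also have "\<dots> \<le> expectation (\<lambda>\<omega>. l\<^sup>2 - 1 + (\<Sum>i\<in>I. exp (l * Y i \<omega>) / exp (l\<^sup>2)))"
  proof (intro integral_mono)
    show "integrable M (\<lambda>\<omega>. l * ?Z \<omega>)"
      using I Y by (intro integrable_mult_right integrable_Max std_normal_integrable) auto
    show "integrable M (\<lambda>\<omega>. l\<^sup>2 - 1 + (\<Sum>i\<in>I. exp (l * Y i \<omega>) / exp (l\<^sup>2)))"
      using Y by (simp add: std_normal_moment_generating_function)
  qed (rule pointwise)
  also have "\<dots> = l\<^sup>2 - 1 + (\<Sum>i\<in>I. expectation (\<lambda>\<omega>. exp (l * Y i \<omega>)) / exp (l\<^sup>2))"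
    using Y by (simp add: std_normal_moment_generating_function prob_space)
  also have "\<dots> = l\<^sup>2 - 1 + n * (exp (l\<^sup>2 / 2) / exp (l\<^sup>2))"
    using Y by (simp add: std_normal_moment_generating_function n_def)
  also have "exp (l\<^sup>2 / 2) = n"
    using n by (simp add: l)
  also have "exp (l\<^sup>2) = n * n"
    using n by (simp add: l exp_double) (simp add: power2_eq_square)
  finally have "l * expectation ?Z \<le> l * l"
    using n by (simp add: power2_eq_square)
  then have "expectation ?Z \<le> l"
    using l(1) by simp
  then show ?thesis
    by (simp add: l_def n_def)
qed

section \<open>Lower bound on the expected maximum\<close>

text \<open>The density is at least its value at \<open>2 * t\<close> on all of \<open>{t..2 * t}\<close>. This crude estimate has the
  merit that for \<open>t = sqrt (ln n) / 2\<close> it equals a constant times \<open>sqrt (ln n) / sqrt n\<close>,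
  which is much larger than \<open>1 / n\<close>.\<close>

lemma std_normal_tail_ge:
  assumes "t \<ge> 0"
  shows "measure std_normal_distribution {t..} \<ge> t * std_normal_density (2 * t)"
proof -
  interpret prob_space std_normal_distribution by (rule prob_space_normal_density) simp
  have "ennreal (t * std_normal_density (2 * t)) =
      (\<integral>\<^sup>+ x. ennreal (std_normal_density (2 * t)) * indicator {t..2*t} x \<partial>lborel)"
    using assms by (simp add: nn_integral_cmult_indicator ennreal_mult' mult.commute)
  also have "\<dots> \<le> (\<integral>\<^sup>+ x. ennreal (std_normal_density x) * indicator {t..} x \<partial>lborel)"
    using assms
    by (intro nn_integral_mono)
       (auto split: split_indicator simp: std_normal_density_def divide_simps
         intro!: power_mono[where n=2 and b="2 * t", simplified])
  also have "\<dots> = emeasure std_normal_distribution {t..}"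
    by (simp add: emeasure_density)
  also have "\<dots> = ennreal (measure std_normal_distribution {t..})"
    by (rule emeasure_eq_measure)
  finally show ?thesis by simp
qed

lemma (in prob_space) expectation_indicator_std_normal:
  assumes X: "distributed M lborel X std_normal_density" and A: "A \<in> sets borel"
  shows "expectation (\<lambda>\<omega>. indicator A (X \<omega>)) = measure std_normal_distribution A"
proof -
  have "expectation (\<lambda>\<omega>. indicator A (X \<omega>)) = (\<integral>x. indicat_real A x \<partial>distr M lborel X)"
    using A distributed_measurable[OF X] by (intro integral_distr[symmetric]) auto
  also have "\<dots> = measure std_normal_distribution A"
    by (simp add: distributed_distr_eq_density[OF X])
  finally show ?thesis .
qed

text \<open>Single out one variable \<open>Y j\<close>. If one of the others reaches \<open>t\<close>, the maximum is at least \<open>t\<close>;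
  otherwise it is at least \<open>Y j\<close>, which is centred and independent of that event. So the second
  case contributes 0 to the expectation of the lower bound, and what remains is \<open>t\<close> times the
  probability of the first case.\<close>

lemma (in prob_space) expectation_Max_std_normal_ge:
  assumes I: "finite I" "I \<noteq> {}" and t: "t \<ge> 0"
    and Y: "\<And>i. i \<in> I \<Longrightarrow> distributed M lborel (Y i) std_normal_density"
    and ind: "indep_vars (\<lambda>_. borel) Y I"
  shows "t * (1 - measure std_normal_distribution {..<t} ^ (card I - 1))
           \<le> expectation (\<lambda>\<omega>. MAX i\<in>I. Y i \<omega>)"
proof -
  let ?Z = "\<lambda>\<omega>. MAX i\<in>I. Y i \<omega>"
  obtain j where j: "j \<in> I" using I by auto
  \<comment> \<open>The lower bound is \<open>t\<close> plus the product of \<open>Y j - t\<close> and the indicators of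
    \<open>Y i < t\<close>; as a product of functions of single variables it can be integrated
    factor by factor.\<close>
  define g where "g i = (if i = j then \<lambda>x. x - t else indicator {..<t})" for i
  have [measurable]: "g i \<in> borel_measurable borel" for i
    by (simp add: g_def)
  have [measurable]: "random_variable borel (Y i)" if "i \<in> I" for i
    using ind that by (auto simp: indep_vars_def)
  have int: "integrable M (\<lambda>\<omega>. g i (Y i \<omega>))" if "i \<in> I" for i
  proof (cases "i = j")
    case True
    then show ?thesis using std_normal_integrable[OF Y[OF that]] by (simp add: g_def)
  next
    case False
    then show ?thesis using that
      by (intro integrable_const_bound[where B=1]) (auto simp: g_def)
  qed
  have split: "(\<Prod>i\<in>I. h i) = h j * (\<Prod>i\<in>I - {j}. h i)" for h :: "_ \<Rightarrow> real"
    using I(1) j by (rule prod.remove)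
  have indg: "indep_vars (\<lambda>_. borel) (\<lambda>i \<omega>. g i (Y i \<omega>)) I"
    using ind by (rule indep_vars_compose2) simp
  have pointwise: "t + (\<Prod>i\<in>I. g i (Y i \<omega>)) \<le> ?Z \<omega>" for \<omega>
  proof (cases "\<forall>i\<in>I - {j}. Y i \<omega> < t")
    case True
    then have "(\<Prod>i\<in>I. g i (Y i \<omega>)) = Y j \<omega> - t"
      unfolding split by (simp add: g_def)
    then show ?thesis using I j by simp
  next
    case False
    then obtain i where i: "i \<in> I" "i \<noteq> j" "\<not> Y i \<omega> < t" by auto
    then have "(\<Prod>i\<in>I. g i (Y i \<omega>)) = 0"
      using I by (intro prod_zero) (auto simp: g_def intro!: bexI[of _ i])
    moreover have "t \<le> ?Z \<omega>" using I i by (intro order_trans[OF _ Max_ge, of t "Y i \<omega>"]) auto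
    ultimately show ?thesis by simp
  qed
  have "expectation (\<lambda>\<omega>. \<Prod>i\<in>I. g i (Y i \<omega>)) = (\<Prod>i\<in>I. expectation (\<lambda>\<omega>. g i (Y i \<omega>)))"
    using I(1) indg int by (rule indep_vars_lebesgue_integral)
  also have "\<dots> = - t * (\<Prod>i\<in>I - {j}. measure std_normal_distribution {..<t})"
    unfolding split
    using Y j std_normal_integrable[OF Y[OF j]] standard_normal_distributed_expectation[OF Y[OF j]]
    by (intro arg_cong2[of _ _ _ _ "(*)"] prod.cong refl)
       (auto simp: g_def prob_space expectation_indicator_std_normal)
  also have "\<dots> = - t * measure std_normal_distribution {..<t} ^ (card I - 1)"
    using I j by simp
  finally have "t * (1 - measure std_normal_distribution {..<t} ^ (card I - 1)) =
      expectation (\<lambda>\<omega>. t + (\<Prod>i\<in>I. g i (Y i \<omega>)))"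
    using I indg int by (simp add: indep_vars_integrable prob_space algebra_simps)
  also have "\<dots> \<le> expectation ?Z"
    using I Y int indg pointwise
    by (intro integral_mono)
       (auto intro!: integrable_Max Bochner_Integration.integrable_add
         intro: std_normal_integrable indep_vars_integrable)
  finally show ?thesis .
qed

text \<open>Here \<open>max a b = (a + b + \<bar>a - b\<bar>) / 2\<close>, and the difference of the two variables is again
  Gaussian.\<close>

lemma (in prob_space) expectation_max_two_std_normal:
  assumes ij: "i \<noteq> j"
    and Y: "distributed M lborel (Y i) std_normal_density" "distributed M lborel (Y j) std_normal_density"
    and ind: "indep_vars (\<lambda>_. borel) Y {i, j}"
  shows "expectation (\<lambda>\<omega>. max (Y i \<omega>) (Y j \<omega>)) = 1 / sqrt pi"
proof -
  let ?D = "\<lambda>\<omega>. Y i \<omega> - Y j \<omega>"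
  have "indep_var borel (Y i) borel (Y j)"
    using indep_vars_sum[of "{j}" i Y] ij ind by simp
  from diff_indep_normal[OF this _ _ Y]
  have D: "distributed M lborel ?D (normal_density 0 (sqrt 2))" by simp
  have "has_bochner_integral lborel (\<lambda>x. normal_density 0 (sqrt 2) x * \<bar>x\<bar>) (sqrt 2 * sqrt (2 / pi))"
    using normal_moment_abs_odd[of "sqrt 2" 0 0] by (simp add: mult.commute)
  then have absD: "integrable M (\<lambda>\<omega>. \<bar>?D \<omega>\<bar>)" "expectation (\<lambda>\<omega>. \<bar>?D \<omega>\<bar>) = sqrt 2 * sqrt (2 / pi)"
    using distributed_integrable[OF D, of abs] distributed_integral[OF D, of abs]
    by (auto simp: has_bochner_integral_iff)
  have "max (Y i \<omega>) (Y j \<omega>) = (Y i \<omega> + Y j \<omega> + \<bar>?D \<omega>\<bar>) / 2" for \<omega>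
    by (auto simp: max_def)
  then have "expectation (\<lambda>\<omega>. max (Y i \<omega>) (Y j \<omega>)) =
      expectation (\<lambda>\<omega>. (Y i \<omega> + Y j \<omega> + \<bar>?D \<omega>\<bar>) / 2)"
    by (simp only:)
  also have "\<dots> = sqrt 2 * sqrt (2 / pi) / 2"
    using absD Y by (simp add: std_normal_integrable standard_normal_distributed_expectation)
  also have "\<dots> = 1 / sqrt pi"
    by (simp add: real_sqrt_divide)
  finally show ?thesis .
qed

lemma integral_Max_mono:
  fixes X :: "'i \<Rightarrow> 'a \<Rightarrow> real"
  assumes "finite I" "J \<subseteq> I" "J \<noteq> {}" "\<And>i. i \<in> I \<Longrightarrow> integrable M (X i)"
  shows "(\<integral>\<omega>. (MAX i\<in>J. X i \<omega>) \<partial>M) \<le> (\<integral>\<omega>. (MAX i\<in>I. X i \<omega>) \<partial>M)"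
  using assms
  by (intro integral_mono integrable_Max Max_mono image_mono) (auto intro: finite_subset)

lemma exp_minus_six_fifths_le: "exp (- (6 / 5)) \<le> (0.32 :: real)"
proof -
  have "(1.78 :: real) \<le> exp (3 / 5)"
    using exp_lower_Taylor_quadratic[of "3 / 5 :: real"] by (simp add: power2_eq_square)
  then have "(1.78 :: real) * 1.78 \<le> exp (3 / 5) * exp (3 / 5)"
    by (intro mult_mono) auto
  then have "(3.168 :: real) \<le> exp (6 / 5)"
    by (simp flip: exp_add)
  then have "inverse (exp (6 / 5)) \<le> inverse (3.168 :: real)"
    by (intro le_imp_inverse_le) auto
  then show ?thesis by (simp add: exp_minus)
qed

text \<open>For at most 16 variables it is enough to look at two of them: the maximum of two already has
  expectation \<open>1 / sqrt pi\<close>, which exceeds \<open>0.3381 * sqrt (ln 16)\<close>. For more variables the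
  threshold bound is used with \<open>t = sqrt (ln n) / 2\<close>; then the expected number of the other variables
  above \<open>t\<close> is at least \<open>6 / 5\<close>, so that with probability at least \<open>0.68\<close> one
  of them is, and \<open>0.68 / 2 > 0.3381\<close>.\<close>

lemma (in prob_space) sqrt_ln_le_expectation_Max_std_normal:
  assumes I: "finite I" "I \<noteq> {}"
    and Y: "\<And>i. i \<in> I \<Longrightarrow> distributed M lborel (Y i) std_normal_density"
    and ind: "indep_vars (\<lambda>_. borel) Y I"
  shows "0.3381 * sqrt (ln (card I)) \<le> expectation (\<lambda>\<omega>. MAX i\<in>I. Y i \<omega>)"
proof -
  define n where "n = real (card I)"
  have "card I > 0" using I by (simp add: card_gt_0_iff)
  then consider "card I = 1" | "2 \<le> card I" "card I \<le> 16" | "16 < card I" by linarith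
  then show ?thesis
  proof cases
    case 1
    then obtain i where "I = {i}" by (rule card_1_singletonE)
    then show ?thesis
      using Y standard_normal_distributed_expectation[of "Y i"] by simp
  next
    case 2
    obtain i j where ij: "i \<in> I" "j \<in> I" "i \<noteq> j"
      using 2(1) I by (metis card_le_Suc0_iff_eq not_less_eq_eq numeral_2_eq_2)
    have "ln n \<le> ln (2 ^ 4)"
      using 2 by (simp add: n_def)
    also have "\<dots> = 4 * ln 2"
      by (simp only: ln_realpow[of 2 4])
    finally have "ln n \<le> 25 / 9"
      using ln2_le_25_over_36 by simp
    then have "0.3381\<^sup>2 * ln n * pi \<le> 0.3381\<^sup>2 * (25 / 9) * 3.1416"
      using pi_approx 2 by (intro mult_mono) (auto simp: n_def)
    also have "\<dots> \<le> 1" by (simp add: power2_eq_square)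
    finally have "0.3381\<^sup>2 * ln n \<le> 1 / pi"
      by (simp add: field_simps)
    then have "sqrt (0.3381\<^sup>2 * ln n) \<le> sqrt (1 / pi)"
      by (rule real_sqrt_le_mono)
    then have "0.3381 * sqrt (ln n) \<le> 1 / sqrt pi"
      by (simp add: real_sqrt_mult real_sqrt_divide)
    also have "\<dots> = expectation (\<lambda>\<omega>. MAX k\<in>{i, j}. Y k \<omega>)"
      using expectation_max_two_std_normal[OF ij(3) Y[OF ij(1)] Y[OF ij(2)]] ij
        indep_vars_subset[OF ind, of "{i, j}"] by simp
    also have "\<dots> \<le> expectation (\<lambda>\<omega>. MAX i\<in>I. Y i \<omega>)"
      using I ij Y by (intro integral_Max_mono) (auto intro: std_normal_integrable)
    finally show ?thesis by (simp add: n_def)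
  next
    case 3
    interpret N: prob_space std_normal_distribution by (rule prob_space_normal_density) simp
    have n: "n \<ge> 16" using 3 by (simp add: n_def)
    define t where "t = sqrt (ln n) / 2"
    define q where "q = measure std_normal_distribution {t..}"
    have "ln (2 ^ 4) \<le> ln n"
      using n by (subst ln_le_cancel_iff) auto
    moreover have "ln (2 ^ 4 :: real) = 4 * ln 2"
      by (simp only: ln_realpow[of 2 4])
    ultimately have ln_n: "8 / 3 \<le> ln n"
      using ln2_ge_two_thirds by simp
    then have t: "t \<ge> 0" "t\<^sup>2 \<ge> 2 / 3"
      by (auto simp: t_def power_divide)
    have "std_normal_density (2 * t) = 1 / (sqrt (2 * pi) * sqrt n)"
    proof -
      have "exp (- (2 * t)\<^sup>2 / 2) = exp (- (ln n / 2))"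
        using ln_n by (simp add: t_def)
      also have "\<dots> = 1 / sqrt n"
        using n by (simp add: exp_minus ln_sqrt[symmetric] inverse_eq_divide)
      finally show ?thesis by (simp add: std_normal_density_def)
    qed
    then have q: "t / (sqrt (2 * pi) * sqrt n) \<le> q"
      using std_normal_tail_ge[OF t(1)] by (simp add: q_def)
    have "(6 / 5) \<le> q * (n - 1)"
    proof -
      have "(6 / 5)\<^sup>2 * (2 * pi * n) \<le> (6 / 5)\<^sup>2 * (2 * 3.1416 * n)"
        using pi_approx n by (intro mult_left_mono mult_right_mono) auto
      also have "\<dots> \<le> 2 / 3 * (n - 1)\<^sup>2"
      proof -
        \<comment> \<open>The factor 14 is enough, as \<open>(6 / 5)\<^sup>2 * 2 * 3.1416 < 2 / 3 * 14\<close>.\<close>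
        have "14 * n \<le> (n - 1)\<^sup>2"
          using mult_mono[of 16 n 0 "n - 16"] n mult_right_mono[of 16 n "n - 16"]
          by (simp add: power2_eq_square algebra_simps)
        then show ?thesis using n by (simp add: power2_eq_square)
      qed
      also have "\<dots> \<le> t\<^sup>2 * (n - 1)\<^sup>2"
        using t by (intro mult_right_mono) auto
      finally have "((6 / 5) * (sqrt (2 * pi) * sqrt n))\<^sup>2 \<le> (t * (n - 1))\<^sup>2"
        using n by (simp only: power_mult_distrib) simp
      then have "(6 / 5) * (sqrt (2 * pi) * sqrt n) \<le> t * (n - 1)"
        using t n by (auto intro: power2_le_imp_le)
      then have "6 / 5 \<le> t / (sqrt (2 * pi) * sqrt n) * (n - 1)"
        using n by (simp add: field_simps)
      also have "\<dots> \<le> q * (n - 1)"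
        using q n by (intro mult_right_mono) auto
      finally show ?thesis .
    qed
    have compl: "measure std_normal_distribution {..<t} = 1 - q"
    proof -
      have "{..<t} = space std_normal_distribution - {t..}" by auto
      then show ?thesis
        unfolding q_def by (simp only: N.prob_compl[of "{t..}"] sets_density sets_lborel atLeast_borel)
    qed
    have "(1 - q) ^ (card I - 1) \<le> exp (- q) ^ (card I - 1)"
      using exp_ge_add_one_self[of "- q"] N.prob_le_1 by (intro power_mono) (auto simp: q_def)
    also have "\<dots> = exp (- (q * (n - 1)))"
      using 3 by (simp add: n_def of_nat_diff mult.commute flip: exp_of_nat_mult)
    also have "\<dots> \<le> exp (- (6 / 5))"
      using \<open>6 / 5 \<le> q * (n - 1)\<close> by simp
    finally have "(1 - q) ^ (card I - 1) \<le> 0.32"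
      using exp_minus_six_fifths_le by linarith
    then have "t * 0.68 \<le> t * (1 - (1 - q) ^ (card I - 1))"
      using t by (intro mult_left_mono) auto
    also have "\<dots> \<le> expectation (\<lambda>\<omega>. MAX i\<in>I. Y i \<omega>)"
      using expectation_Max_std_normal_ge[OF I t(1) Y ind] by (simp add: compl)
    finally have "0.34 * sqrt (ln n) \<le> expectation (\<lambda>\<omega>. MAX i\<in>I. Y i \<omega>)"
      by (simp add: t_def)
    moreover have "0.3381 * sqrt (ln n) \<le> 0.34 * sqrt (ln n)"
      using ln_n by (intro mult_right_mono) auto
    ultimately show ?thesis unfolding n_def by linarith
  qed
qed

section \<open>The density of the maximum\<close>

abbreviation std_normal_cdf :: "real \<Rightarrow> real" where
  "std_normal_cdf \<equiv> cdf std_normal_distribution"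

lemma std_normal_density_has_derivative:
  "(std_normal_density has_real_derivative - x * std_normal_density x) (at x)"
proof -
  have "((\<lambda>x::real. exp (- x\<^sup>2 / 2)) has_real_derivative - x * exp (- x\<^sup>2 / 2)) (at x)"
    by (auto intro!: derivative_eq_intros)
  from DERIV_cmult[OF this, of "1 / sqrt (2 * pi)"] show ?thesis
    unfolding std_normal_density_def[abs_def] by (simp add: mult.left_commute)
qed

lemma std_normal_density_le_1: "std_normal_density x \<le> 1"
proof -
  have "1 \<le> sqrt (2 * pi)" using pi_gt3 by simp
  then have "1 / sqrt (2 * pi) * exp (- x\<^sup>2 / 2) \<le> 1 * 1"
    by (intro mult_mono) auto
  then show ?thesis by (simp add: std_normal_density_def)
qed

lemma std_normal_cdf_eq_nn_integral:
  "ennreal (std_normal_cdf a) = (\<integral>\<^sup>+x. ennreal (std_normal_density x) * indicator {..a} x \<partial>lborel)"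
proof -
  interpret real_distribution std_normal_distribution by (rule real_dist_normal_dist)
  show ?thesis
    unfolding cdf_def by (simp add: emeasure_density flip: emeasure_eq_measure)
qed

lemma std_normal_cdf_has_derivative:
  "(std_normal_cdf has_real_derivative std_normal_density x) (at x)"
proof -
  interpret real_distribution std_normal_distribution by (rule real_dist_normal_dist)
  define a where "a = x - 1"
  have cont: "continuous_on A std_normal_density" for A
    using DERIV_isCont[OF std_normal_density_has_derivative] continuous_at_imp_continuous_on by blast
  have eq: "std_normal_cdf a + integral {a..y} std_normal_density = std_normal_cdf y" if "a < y" for y
  proof -
    have "std_normal_cdf y - std_normal_cdf a = measure std_normal_distribution {a<..y}"
      using that by (rule cdf_diff_eq)
    also have "\<dots> = (\<integral>z. indicator {a<..y} z \<partial>std_normal_distribution)"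
      by simp
    also have "\<dots> = (\<integral>z. std_normal_density z * indicator {a<..y} z \<partial>lborel)"
      by (intro integral_real_density) auto
    also have "\<dots> = (\<integral>z. indicator {a..y} z *\<^sub>R std_normal_density z \<partial>lborel)"
      using AE_lborel_singleton[of a]
      by (intro integral_cong_AE) (auto split: split_indicator elim!: eventually_mono)
    also have "\<dots> = integral {a..y} std_normal_density"
      using set_borel_integral_eq_integral(2)[OF borel_integrable_atLeastAtMost'[OF cont], of a y]
      by (simp add: set_lebesgue_integral_def)
    finally show ?thesis by simp
  qed
  have "((\<lambda>y. integral {a..y} std_normal_density) has_real_derivative std_normal_density x)
      (at x within {a..x+1})"
    by (rule integral_has_real_derivative[OF cont]) (auto simp: a_def)
  then have "((\<lambda>y. std_normal_cdf a + integral {a..y} std_normal_density) has_real_derivative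
      std_normal_density x) (at x)"
    by (auto intro!: derivative_eq_intros simp: a_def at_within_Icc_at)
  then show ?thesis
  proof (rule has_field_derivative_transform_within_open[where S="{a<..}"])
    show "x \<in> {a<..}" by (simp add: a_def)
  qed (auto simp: eq)
qed

lemma std_normal_cdf_bounds:
  "0 < std_normal_cdf x" "std_normal_cdf x \<le> 1"
proof -
  interpret real_distribution std_normal_distribution by (rule real_dist_normal_dist)
  show "std_normal_cdf x \<le> 1" by (rule cdf_bounded_prob)
  have "std_normal_cdf (x - 1) < std_normal_cdf x"
  proof (rule DERIV_pos_imp_increasing[where f=std_normal_cdf])
    show "\<exists>z. DERIV std_normal_cdf y :> z \<and> z > 0" if "x - 1 \<le> y" "y \<le> x" for y
      using std_normal_cdf_has_derivative[of y] normal_density_pos[of 1 0 y] by auto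
  qed simp
  then show "0 < std_normal_cdf x"
    using cdf_nonneg[of "x - 1"] by linarith
qed

text \<open>The ratio of density to distribution function is decreasing, that is, the Gaussian
  distribution function is log-concave. Substituting \<open>x - s\<close> for the integration variable,
  \<open>std_normal_cdf x / std_normal_density x\<close> is the integral of \<open>exp (x * s - s\<^sup>2 / 2)\<close> over
  \<open>s \<ge> 0\<close>, and this integrand increases with \<open>x\<close>. The inequality is this monotonicity with
  denominators cleared.\<close>

lemma std_normal_cdf_cross_le:
  assumes "x \<le> y"
  shows "std_normal_density y * std_normal_cdf x \<le> std_normal_density x * std_normal_cdf y"
proof -
  have shift: "ennreal (std_normal_cdf u) =
      (\<integral>\<^sup>+s. ennreal (std_normal_density (u - s)) * indicator {0..} s \<partial>lborel)" for u
    unfolding std_normal_cdf_eq_nn_integral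
    by (subst nn_integral_real_affine[where c="-1" and t=u])
       (auto intro!: nn_integral_cong split: split_indicator)
  have le: "std_normal_density y * std_normal_density (x - s) \<le>
      std_normal_density x * std_normal_density (y - s)" if "s \<ge> 0" for s
  proof -
    have "x * s \<le> y * s" using assms that by (rule mult_right_mono)
    then have "- y\<^sup>2 / 2 - (x - s)\<^sup>2 / 2 \<le> - x\<^sup>2 / 2 - (y - s)\<^sup>2 / 2"
      by (simp add: power2_eq_square field_simps)
    then show ?thesis
      by (simp add: std_normal_density_def divide_simps flip: exp_add)
  qed
  have "ennreal (std_normal_density y * std_normal_cdf x) =
      (\<integral>\<^sup>+s. ennreal (std_normal_density y * std_normal_density (x - s)) * indicator {0..} s \<partial>lborel)"
    by (simp add: ennreal_mult' shift mult.assoc nn_integral_cmult)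
  also have "\<dots> \<le> (\<integral>\<^sup>+s. ennreal (std_normal_density x * std_normal_density (y - s)) * indicator {0..} s \<partial>lborel)"
    by (intro nn_integral_mono) (auto split: split_indicator intro: le)
  also have "\<dots> = ennreal (std_normal_density x * std_normal_cdf y)"
    by (simp add: ennreal_mult' shift mult.assoc nn_integral_cmult)
  finally show ?thesis
    using std_normal_cdf_bounds(1)[of y] by (simp add: ennreal_le_iff)
qed

text \<open>With \<open>T = 0\<close> and a distribution function for \<open>F\<close>, this identifies the derivative of \<open>F\<close> as the
  density. It follows from \<open>nn_integral_FTC_atLeast\<close> by reflection.\<close>

lemma nn_integral_FTC_atMost:
  fixes f F :: "real \<Rightarrow> real"
  assumes f_borel: "f \<in> borel_measurable borel"
    and f: "\<And>x. x \<le> a \<Longrightarrow> DERIV F x :> f x"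
    and nonneg: "\<And>x. x \<le> a \<Longrightarrow> 0 \<le> f x"
    and lim: "(F \<longlongrightarrow> T) at_bot"
  shows "(\<integral>\<^sup>+x. ennreal (f x) * indicator {..a} x \<partial>lborel) = ennreal (F a - T)"
proof -
  have "(\<integral>\<^sup>+x. ennreal (f x) * indicator {..a} x \<partial>lborel) =
      (\<integral>\<^sup>+x. ennreal (f (- x)) * indicator {-a..} x \<partial>lborel)"
    using f_borel
    by (subst nn_integral_real_affine[where c="-1" and t=0])
       (auto intro!: nn_integral_cong split: split_indicator)
  also have "\<dots> = ennreal (- T - - F (- (- a)))"
  proof (rule nn_integral_FTC_atLeast[where F="\<lambda>x. - F (- x)"])
    show "(\<lambda>x. f (- x)) \<in> borel_measurable borel"
      using f_borel by measurable
    show "DERIV (\<lambda>x. - F (- x)) x :> f (- x)" if "- a \<le> x" for x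
      using f[of "- x"] that by (auto intro!: derivative_eq_intros DERIV_chain2[of F])
    show "((\<lambda>x. - F (- x)) \<longlongrightarrow> - T) at_top"
      by (intro tendsto_minus filterlim_compose[OF lim] filterlim_uminus_at_bot_at_top)
  qed (auto intro: nonneg)
  finally show ?thesis by simp
qed

definition max_std_normal_density :: "nat \<Rightarrow> real \<Rightarrow> real" where
  "max_std_normal_density n x = n * (std_normal_density x * std_normal_cdf x ^ (n - 1))"

lemma std_normal_cdf_measurable [measurable]: "std_normal_cdf \<in> borel_measurable borel"
  using DERIV_isCont[OF std_normal_cdf_has_derivative]
  by (intro borel_measurable_continuous_onI continuous_at_imp_continuous_on) auto

lemma max_std_normal_density_measurable [measurable]:
  "max_std_normal_density n \<in> borel_measurable borel"
  unfolding max_std_normal_density_def[abs_def] by measurable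

lemma max_std_normal_density_bounds:
  "0 \<le> max_std_normal_density n x" "max_std_normal_density n x \<le> n * std_normal_density x"
  using std_normal_cdf_bounds[of x]
  by (auto simp: max_std_normal_density_def power_le_one intro!: mult_nonneg_nonneg mult_left_mono mult_left_le)

text \<open>The distribution function of the maximum is the \<open>n\<close>-th power of the Gaussian one, and
  \<open>max_std_normal_density n\<close> is its derivative.\<close>

lemma (in prob_space) Max_std_normal_distributed:
  assumes I: "finite I" "I \<noteq> {}"
    and Y: "\<And>i. i \<in> I \<Longrightarrow> distributed M lborel (Y i) std_normal_density"
    and ind: "indep_vars (\<lambda>_. borel) Y I"
  shows "distributed M lborel (\<lambda>\<omega>. MAX i\<in>I. Y i \<omega>) (max_std_normal_density (card I))"
proof (rule distributedI_borel_atMost[where g="\<lambda>a. std_normal_cdf a ^ card I"])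
  interpret N: real_distribution std_normal_distribution by (rule real_dist_normal_dist)
  have [measurable]: "random_variable borel (Y i)" if "i \<in> I" for i
    using ind that by (auto simp: indep_vars_def)
  show "(\<lambda>\<omega>. MAX i\<in>I. Y i \<omega>) \<in> borel_measurable M"
    using I by measurable
  show "AE x in lborel. 0 \<le> max_std_normal_density (card I) x"
    by (simp add: max_std_normal_density_bounds)
  show "(\<integral>\<^sup>+x. max_std_normal_density (card I) x * indicator {..a} x \<partial>lborel) =
      ennreal (std_normal_cdf a ^ card I)" for a
  proof -
    have "((\<lambda>x. std_normal_cdf x ^ card I) \<longlongrightarrow> 0) at_bot"
      using tendsto_power[OF N.cdf_lim_at_bot, of "card I"] I by (simp add: zero_power card_gt_0_iff)
    then have "(\<integral>\<^sup>+x. ennreal (max_std_normal_density (card I) x) * indicator {..a} x \<partial>lborel) =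
        ennreal (std_normal_cdf a ^ card I)"
      using max_std_normal_density_bounds(1)[of "card I"]
      by (subst nn_integral_FTC_atMost[where F="\<lambda>x. std_normal_cdf x ^ card I" and T=0])
         (auto simp: max_std_normal_density_def intro!: derivative_eq_intros std_normal_cdf_has_derivative)
    then show ?thesis
      by (simp add: ennreal_mult'' ennreal_indicator)
  qed
  show "emeasure M {\<omega> \<in> space M. (MAX i\<in>I. Y i \<omega>) \<le> a} = ennreal (std_normal_cdf a ^ card I)" for a
  proof -
    have "prob (Y i -` {..a} \<inter> space M) = std_normal_cdf a" if "i \<in> I" for i
      using distributed_distr_eq_density[OF Y[OF that], symmetric] distributed_measurable[OF Y[OF that]]
      by (simp add: cdf_def measure_distr)
    moreover have "{\<omega> \<in> space M. (MAX i\<in>I. Y i \<omega>) \<le> a} = (\<Inter>i\<in>I. Y i -` {..a} \<inter> space M)"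
      using I by (auto simp: Max_le_iff)
    ultimately show ?thesis
      using indep_varsD_finite[OF ind I(2,1), of "\<lambda>_. {..a}"] by (simp add: emeasure_eq_measure)
  qed
qed simp

section \<open>Variance of the maximum\<close>

lemma integral_derivative_eq_0:
  fixes g g' :: "real \<Rightarrow> real"
  assumes "\<And>x. DERIV g x :> g' x" "\<And>x. isCont g' x" "integrable lborel g'"
    and "(g \<longlongrightarrow> 0) at_bot" "(g \<longlongrightarrow> 0) at_top"
  shows "(\<integral>x. g' x \<partial>lborel) = 0"
proof -
  have "(LBINT x=-\<infinity>..\<infinity>. g' x) = 0 - 0"
    using assms
    by (intro interval_integral_FTC_integrable[where F=g])
       (auto simp: ereal_tendsto_simps set_integrable_def has_real_derivative_iff_has_vector_derivative)
  then show ?thesis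
    by (simp add: interval_integral_to_infinity_eq set_lebesgue_integral_def interval_lebesgue_integral_def)
qed

lemma tendsto_mult_std_normal_density:
  "((\<lambda>x. (\<bar>x\<bar> + a) * std_normal_density x) \<longlongrightarrow> 0) at_top"
  "((\<lambda>x. (\<bar>x\<bar> + a) * std_normal_density x) \<longlongrightarrow> 0) at_bot"
  unfolding std_normal_density_def by real_asymp+

text \<open>The density \<open>p\<close> of the maximum satisfies \<open>p' x = (- x + r x) * p x\<close>, where \<open>r\<close> is
  \<open>n - 1\<close> times the decreasing ratio of density to distribution function. The second summand
  below is \<open>r x * p x\<close>.\<close>

lemma max_std_normal_density_has_derivative:
  "(max_std_normal_density n has_real_derivative
     - x * max_std_normal_density n x
       + real n * real (n - 1) * (std_normal_density x)\<^sup>2 * std_normal_cdf x ^ (n - 2)) (at x)"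
  unfolding max_std_normal_density_def[abs_def]
  by (cases n)
     (auto intro!: derivative_eq_intros std_normal_cdf_has_derivative std_normal_density_has_derivative
       simp: algebra_simps power2_eq_square numeral_2_eq_2)

text \<open>The one-dimensional case of the Brascamp-Lieb inequality: a density \<open>p\<close> for which
  \<open>- p' x / p x - x\<close> is increasing has variance at most 1. For the proof, let \<open>m\<close> be the mean. The
  derivative of \<open>(x - m) * p x\<close> integrates to zero. It is
  \<open>p x - (x - m) * x * p x + (x - m) * r x * p x\<close> with \<open>r\<close> decreasing, so replacing \<open>r x\<close> by the
  constant \<open>r m\<close> can only increase it. Constants contribute nothing after multiplication with
  the centred factor \<open>x - m\<close>, and therefore the integral of the result is 1 minus the variance.\<close>

lemma (in prob_space) variance_Max_std_normal_le_1:
  assumes I: "finite I" "I \<noteq> {}"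
    and Y: "\<And>i. i \<in> I \<Longrightarrow> distributed M lborel (Y i) std_normal_density"
    and ind: "indep_vars (\<lambda>_. borel) Y I"
  shows "variance (\<lambda>\<omega>. MAX i\<in>I. Y i \<omega>) \<le> 1"
proof -
  let ?Z = "\<lambda>\<omega>. MAX i\<in>I. Y i \<omega>"
  define n where "n = card I"
  define m where "m = expectation ?Z"
  let ?p = "max_std_normal_density n"
  \<comment> \<open>\<open>s x\<close> stands for \<open>r x * p x\<close> of the preceding explanation, and \<open>r\<close> for the value \<open>r m\<close>.\<close>
  define s where "s x = real n * real (n - 1) * (std_normal_density x)\<^sup>2 * std_normal_cdf x ^ (n - 2)" for x
  define r where "r = real (n - 1) * std_normal_density m / std_normal_cdf m"
  note bounds = max_std_normal_density_bounds[of n]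
  have Z: "distributed M lborel ?Z ?p"
    unfolding n_def using assms by (rule Max_std_normal_distributed)
  have moment_integrable: "integrable lborel (\<lambda>x. ?p x * x ^ k)" for k
  proof (rule Bochner_Integration.integrable_bound)
    show "integrable lborel (\<lambda>x. n * (std_normal_density x * \<bar>x\<bar> ^ k))"
      by (intro integrable_mult_right integrable_std_normal_moment_abs)
    show "AE x in lborel. norm (?p x * x ^ k) \<le> norm (n * (std_normal_density x * \<bar>x\<bar> ^ k))"
      using bounds by (auto simp: abs_mult power_abs mult.assoc[symmetric] intro!: AE_I2 mult_right_mono)
  qed simp
  have p0: "integrable lborel ?p" "(\<integral>x. ?p x \<partial>lborel) = 1"
    using moment_integrable[of 0] distributed_integral[OF Z, of "\<lambda>_. 1"] bounds
    by (auto simp: prob_space)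
  have p1: "integrable lborel (\<lambda>x. ?p x * x)" "(\<integral>x. ?p x * x \<partial>lborel) = m"
    using moment_integrable[of 1] distributed_integral[OF Z, of "\<lambda>x. x"] bounds
    by (auto simp: m_def)
  have centered: "integrable lborel (\<lambda>x. ?p x * (x - m))" "(\<integral>x. ?p x * (x - m) \<partial>lborel) = 0"
    using p0 p1 by (auto simp: right_diff_distrib)
  have square: "integrable lborel (\<lambda>x. ?p x * (x - m)\<^sup>2)"
    "(\<integral>x. ?p x * (x - m)\<^sup>2 \<partial>lborel) = variance ?Z"
  proof -
    have "?p x * (x - m)\<^sup>2 = ?p x * x ^ 2 - 2 * m * (?p x * x) + m\<^sup>2 * ?p x" for x
      by (simp add: power2_diff algebra_simps)
    then show "integrable lborel (\<lambda>x. ?p x * (x - m)\<^sup>2)"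
      using p0 p1 moment_integrable[of 2] by simp
    show "(\<integral>x. ?p x * (x - m)\<^sup>2 \<partial>lborel) = variance ?Z"
      using distributed_integral[OF Z, of "\<lambda>x. (x - m)\<^sup>2"] bounds by (simp add: m_def)
  qed
  let ?g = "\<lambda>x. (x - m) * ?p x"
  let ?g' = "\<lambda>x. ?p x - ?p x * (x - m) * x + (x - m) * s x"
  have g': "DERIV ?g x :> ?g' x" for x
    by (auto intro!: derivative_eq_intros max_std_normal_density_has_derivative
        simp: s_def algebra_simps)
  have isCont: "isCont std_normal_cdf x" "isCont std_normal_density x" "isCont ?p x" for x
    using DERIV_isCont std_normal_cdf_has_derivative std_normal_density_has_derivative
      max_std_normal_density_has_derivative by blast+
  have s_int: "integrable lborel (\<lambda>x. (x - m) * s x)"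
  proof -
    define c where "c = real n * real (n - 1)"
    have c: "c \<ge> 0" by (simp add: c_def)
    show ?thesis
    proof (rule Bochner_Integration.integrable_bound)
      show "integrable lborel (\<lambda>x. c * (std_normal_density x * \<bar>x\<bar> ^ 1 + \<bar>m\<bar> * std_normal_density x))"
        by (intro integrable_mult_right Bochner_Integration.integrable_add integrable_std_normal_moment_abs
            integrable_normal_density) simp
      have "\<bar>(x - m) * s x\<bar> \<le> c * (std_normal_density x * \<bar>x\<bar> ^ 1 + \<bar>m\<bar> * std_normal_density x)" for x
      proof -
        have "(std_normal_density x)\<^sup>2 * std_normal_cdf x ^ (n - 2) \<le> std_normal_density x * 1"
          using std_normal_density_le_1[of x] std_normal_cdf_bounds[of x]
          by (intro mult_mono) (auto simp: power2_eq_square power_le_one mult_left_le)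
        then have "\<bar>x - m\<bar> * (c * ((std_normal_density x)\<^sup>2 * std_normal_cdf x ^ (n - 2)))
            \<le> (\<bar>x\<bar> + \<bar>m\<bar>) * (c * std_normal_density x)"
          using c std_normal_cdf_bounds[of x] by (intro mult_mono mult_left_mono) auto
        moreover have "\<bar>s x\<bar> = c * ((std_normal_density x)\<^sup>2 * std_normal_cdf x ^ (n - 2))"
          using c std_normal_cdf_bounds[of x] by (simp add: s_def c_def abs_mult)
        ultimately show ?thesis
          unfolding abs_mult by (simp add: algebra_simps)
      qed
      then show "AE x in lborel. norm ((x - m) * s x) \<le>
          norm (c * (std_normal_density x * \<bar>x\<bar> ^ 1 + \<bar>m\<bar> * std_normal_density x))"
        by (intro AE_I2) (simp add: order_trans[OF _ abs_ge_self])
    qed (simp add: s_def[abs_def])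
  qed
  have g'_int: "integrable lborel ?g'"
  proof -
    have "?p x * (x - m) * x = ?p x * (x - m)\<^sup>2 + m * (?p x * (x - m))" for x
      by (simp add: power2_eq_square algebra_simps)
    then have "integrable lborel (\<lambda>x. ?p x * (x - m) * x)"
      using square(1) centered(1) by simp
    then show ?thesis
      using p0(1) s_int by simp
  qed
  have g_bound: "norm (?g x) \<le> n * ((\<bar>x\<bar> + \<bar>m\<bar>) * std_normal_density x)" for x
  proof -
    have "\<bar>x - m\<bar> * ?p x \<le> (\<bar>x\<bar> + \<bar>m\<bar>) * (n * std_normal_density x)"
      using bounds by (intro mult_mono) auto
    then show ?thesis
      using bounds(1) unfolding real_norm_def abs_mult by (simp add: mult_ac)
  qed
  have g'_integral: "(\<integral>x. ?g' x \<partial>lborel) = 0"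
  proof (rule integral_derivative_eq_0)
    show "isCont ?g' x" for x
      unfolding s_def by (intro continuous_intros isCont)
    show "(?g \<longlongrightarrow> 0) at_bot"
      using tendsto_mult_right_zero[OF tendsto_mult_std_normal_density(2)[of "\<bar>m\<bar>"], of "real n"]
      by (rule Lim_null_comparison[OF always_eventually, rotated]) (use g_bound in auto)
    show "(?g \<longlongrightarrow> 0) at_top"
      using tendsto_mult_right_zero[OF tendsto_mult_std_normal_density(1)[of "\<bar>m\<bar>"], of "real n"]
      by (rule Lim_null_comparison[OF always_eventually, rotated]) (use g_bound in auto)
  qed (use g' g'_int in auto)
  have "(\<integral>x. ?g' x \<partial>lborel) \<le>
      (\<integral>x. ?p x - ?p x * (x - m)\<^sup>2 + (r - m) * (?p x * (x - m)) \<partial>lborel)"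
  proof (rule integral_mono[OF g'_int])
    show "integrable lborel (\<lambda>x. ?p x - ?p x * (x - m)\<^sup>2 + (r - m) * (?p x * (x - m)))"
      using p0 square centered by simp
    fix x
    \<comment> \<open>Monotonicity of the ratio \<open>r\<close>: the sign of \<open>x - m\<close> matches the direction of the inequality.\<close>
    have "(x - m) * s x \<le> (x - m) * (r * ?p x)"
    proof (cases "n \<le> 1")
      case True
      then have "n = 0 \<or> n = 1" by auto
      then show ?thesis by (auto simp: s_def r_def max_std_normal_density_def)
    next
      case False
      then obtain l where l: "n = Suc (Suc l)"
        by (metis One_nat_def not0_implies_Suc not_less_eq_eq zero_le)
      define K where "K = real n * real (n - 1) * std_normal_density x * std_normal_cdf x ^ l / std_normal_cdf m"
      have K: "K \<ge> 0" using std_normal_cdf_bounds by (simp add: K_def less_imp_le)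
      have "s x = K * (std_normal_density x * std_normal_cdf m)"
        using std_normal_cdf_bounds[of m] by (simp add: s_def K_def l power2_eq_square)
      moreover have "r * ?p x = K * (std_normal_density m * std_normal_cdf x)"
        by (simp add: r_def K_def l max_std_normal_density_def)
      ultimately have sK: "s x = K * (std_normal_density x * std_normal_cdf m)"
        and rK: "r * ?p x = K * (std_normal_density m * std_normal_cdf x)" .
      show ?thesis
      proof (cases "m \<le> x")
        case True
        then show ?thesis
          unfolding sK rK using std_normal_cdf_cross_le[of m x] K by (intro mult_left_mono) auto
      next
        case False
        then show ?thesis
          unfolding sK rK using std_normal_cdf_cross_le[of x m] K
          by (intro mult_left_mono_neg mult_left_mono) auto
      qed
    qed
    then show "?g' x \<le> ?p x - ?p x * (x - m)\<^sup>2 + (r - m) * (?p x * (x - m))"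
      by (simp add: power2_eq_square algebra_simps)
  qed
  also have "\<dots> = 1 - variance ?Z"
    using p0 square centered by simp
  finally show ?thesis using g'_integral by simp
qed

section \<open>The private aggregate demand\<close>

lemma Max_mult_nonneg:
  fixes f :: "'i \<Rightarrow> real"
  assumes "finite I" "I \<noteq> {}" "c \<ge> 0"
  shows "(MAX i\<in>I. c * f i) = c * (MAX i\<in>I. f i)"
  using mono_Max_commute[of "(*) c" "f ` I"] assms
  by (simp add: mono_def mult_left_mono image_image)

theorem theorem3:
  fixes M :: "'a measure" and P :: "'b measure"
    and N K :: nat and b \<epsilon> :: real
    and w :: "nat \<Rightarrow> nat \<Rightarrow> 'a \<Rightarrow> real"
    and d :: "nat \<Rightarrow> 'b \<Rightarrow> real"
  assumes "prob_space M" and "prob_space P"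
    and "N \<ge> 1" and "K \<ge> 1" and "b > 0" and "\<epsilon> > 0"
    and "prob_space.indep_vars M (\<lambda>_. borel) (\<lambda>(i, k). w i k) ({1..N} \<times> {1..K})"
    and "\<And>i k. i \<in> {1..N} \<Longrightarrow> k \<in> {1..K} \<Longrightarrow>
           distributed M lborel (w i k) (laplace_density (b / \<epsilon>))"
    and "gaussian_surrogate {1..K} M (aggregate_error N w) P d"
  shows "0.478 * sqrt (real N) * (b / \<epsilon>) * sqrt (ln (real K))
           \<le> prob_space.expectation P (\<lambda>\<omega>. MAX k\<in>{1..K}. d k \<omega>) \<and>
         prob_space.expectation P (\<lambda>\<omega>. MAX k\<in>{1..K}. d k \<omega>)
           \<le> 2 * (b / \<epsilon>) * sqrt (real N) * sqrt (ln (real K)) \<and>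
         prob_space.variance P (\<lambda>\<omega>. MAX k\<in>{1..K}. d k \<omega>)
           \<le> 8 * real N * (b\<^sup>2 / \<epsilon>\<^sup>2)"
proof -
  interpret P: prob_space P by fact
  define c where "c = b / \<epsilon>"
  define \<sigma> where "\<sigma> = sqrt 2 * (sqrt N * c)"
  have c: "c > 0" using assms by (simp add: c_def)
  have \<sigma>: "\<sigma> > 0" "\<sigma>\<^sup>2 = 2 * real N * c\<^sup>2"
    using assms c by (auto simp: \<sigma>_def power_mult_distrib)
  have moments: "prob_space.expectation M (aggregate_error N w k) = 0"
      "prob_space.variance M (aggregate_error N w k) = \<sigma>\<^sup>2" if "k \<in> {1..K}" for k
    using aggregate_error_moments[OF assms(1) c that assms(7)] assms(8) \<sigma>(2)
    by (auto simp: c_def)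
  have ind: "P.indep_vars (\<lambda>_. borel) d {1..K}"
    and d: "\<And>k. k \<in> {1..K} \<Longrightarrow> distributed P lborel (d k) (normal_density 0 \<sigma>)"
    using assms(9) moments \<sigma>(1) unfolding gaussian_surrogate_def by auto
  define Y where "Y k \<omega> = d k \<omega> / \<sigma>" for k \<omega>
  have Y: "distributed P lborel (Y k) std_normal_density" if "k \<in> {1..K}" for k
    using d[OF that] P.normal_standard_normal_convert[OF \<sigma>(1), of "d k" 0]
    by (simp add: Y_def[abs_def])
  have indY: "P.indep_vars (\<lambda>_. borel) Y {1..K}"
    unfolding Y_def[abs_def] using ind by (rule P.indep_vars_compose2) simp
  let ?Z = "\<lambda>\<omega>. MAX k\<in>{1..K}. Y k \<omega>"
  have I: "finite {1..K}" "{1..K} \<noteq> {}" using assms(4) by auto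
  have max_d: "(MAX k\<in>{1..K}. d k \<omega>) = \<sigma> * ?Z \<omega>" for \<omega>
    using Max_mult_nonneg[OF I, of \<sigma> "\<lambda>k. Y k \<omega>"] \<sigma>(1) by (simp add: Y_def)
  have E: "P.expectation (\<lambda>\<omega>. MAX k\<in>{1..K}. d k \<omega>) = \<sigma> * P.expectation ?Z"
    unfolding max_d by simp
  have "P.variance (\<lambda>\<omega>. MAX k\<in>{1..K}. d k \<omega>) = \<sigma>\<^sup>2 * P.variance ?Z"
    unfolding E unfolding max_d right_diff_distrib[symmetric] power_mult_distrib by simp
  also have "\<dots> \<le> \<sigma>\<^sup>2 * 1"
    using P.variance_Max_std_normal_le_1[OF I Y indY] by (intro mult_left_mono) auto
  also have "\<dots> \<le> 8 * real N * (b\<^sup>2 / \<epsilon>\<^sup>2)"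
    unfolding \<sigma>(2) by (simp add: c_def power_divide divide_right_mono mult_right_mono)
  finally have var: "P.variance (\<lambda>\<omega>. MAX k\<in>{1..K}. d k \<omega>) \<le> 8 * real N * (b\<^sup>2 / \<epsilon>\<^sup>2)" .
  have "\<sigma> * P.expectation ?Z \<le> \<sigma> * sqrt (2 * ln K)"
    using P.expectation_Max_std_normal_le[OF I Y] \<sigma>(1) by (intro mult_left_mono) auto
  also have "\<dots> = 2 * c * sqrt N * sqrt (ln K)"
    by (simp add: \<sigma>_def real_sqrt_mult)
  finally have upper: "P.expectation (\<lambda>\<omega>. MAX k\<in>{1..K}. d k \<omega>) \<le> 2 * c * sqrt N * sqrt (ln K)"
    unfolding E .
  \<comment> \<open>The stated constant is \<open>sqrt 2\<close> times about \<open>0.33800\<close>, just below \<open>0.3381\<close>.\<close>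
  have "1.414 \<le> sqrt 2"
    by (rule real_le_rsqrt) (simp add: power2_eq_square)
  then have "0.478 * (sqrt N * c * sqrt (ln K)) \<le> (sqrt 2 * 0.3381) * (sqrt N * c * sqrt (ln K))"
    using c assms(4) by (intro mult_right_mono) auto
  also have "\<dots> = \<sigma> * (0.3381 * sqrt (ln K))"
    by (simp add: \<sigma>_def)
  also have "\<dots> \<le> \<sigma> * P.expectation ?Z"
    using P.sqrt_ln_le_expectation_Max_std_normal[OF I Y indY] \<sigma>(1) by (intro mult_left_mono) auto
  finally have lower: "0.478 * sqrt N * c * sqrt (ln K) \<le> P.expectation (\<lambda>\<omega>. MAX k\<in>{1..K}. d k \<omega>)"
    unfolding E by (simp add: mult.assoc)
  from lower upper var show ?thesis
    unfolding c_def by blast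
qed

end
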